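(* The infinite Ferrers diagrams and infinite tableaux are limits of finite ones, in the following sense. (i) For any $\lambda\vdash n$, applying $\lambda\mapsto\lambda_+$ repeatedly produces in the limit an infinite Ferrers diagram $\hat{\lambda}\vdash\infty$ whose finite part is given by $\{\lambda_j\}_{j\geq2}$. Every $\hat{\lambda}\vdash\infty$ is obtained in this way from some $n$ and some $\lambda\vdash n$. (ii) For $T\in\operatorname{SYT}(\lambda)$, repeated application of $\iota$ produces in the limit an infinite standard Young tableau $\hat{T}\in\operatorname{SYT}(\hat{\lambda})$. Every infinite standard Young tableau is obtained in this way from some $n$, $\lambda\vdash n$, and $T\in\operatorname{SYT}(\lambda)$. (iii) For $M\in\operatorname{SSYT}(\lambda)$, repeated application of $\hat{\iota}$ produces in the limit an infinite semi-standard Young tableau $\hat{M}\in\operatorname{SSYT}(\hat{\lambda})$. For every $\hat{\lambda}\vdash\infty$ and every element $\hat{M}$ of $\operatorname{SSYT}(\hat{\lambda})$ there are $n$, $\lambda\vdash n$, and $M\in\operatorname{SSYT}(\lambda)$ for which this process yields $\hat{\lambda}$ and $\hat{M}$. (iv) If the process in (iii) is started with a cocharge tableau $M=C\in\operatorname{CCT}(\lambda)$, then the limit $\hat{C}=\hat{M}$ lies in $\operatorname{CCT}(\hat{\lambda})$. Conversely, if an element $\hat{C}\in\operatorname{CCT}(\hat{\lambda})$ is obtained by this process from a finite tableau $C\in\operatorname{SSYT}(\lambda)$, then $C\in\operatorname{CCT}(\lambda)$.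
   Context: Finite objects. For $\lambda\vdash n$, $\operatorname{SYT}(\lambda)$ is the set of standard Young tableaux of shape $\lambda$ (entries $1,\ldots,n$), and $\operatorname{SSYT}(\lambda)$ is the set of semi-standard Young tableaux of shape $\lambda$ with non-negative integer entries ($0$ allowed; rows weakly increasing, columns strictly increasing downwards). $\operatorname{CCT}(\lambda)$, the set of cocharge tableaux, consists of those $C\in\operatorname{SSYT}(\lambda)$ such that whenever $h>0$ appears in $C$, its leftmost instance lies in a row strictly below some row containing $h-1$. $\lambda_+\vdash n+1$ is obtained from $\lambda$ by adding one box to the first row; $\iota T$ is obtained from $T$ by enlarging the shape to $\lambda_+$ and putting $n+1$ in the new box; $\hat{\iota}M\in\operatorname{SSYT}(\lambda_+)$ is obtained from $M$ by pushing the entries of the first row one box to the right and putting $0$ in the upper left box. Infinite objects. An infinite Ferrers diagram, written $\hat{\lambda}\vdash\infty$, is a Ferrers diagram whose first row is infinite and whose remaining rows form a finite partition diagram, called its finite part. $\operatorname{SYT}(\hat{\lambda})$ is the set of standard fillings of $\hat{\lambda}$: each element of $\mathbb{N}=\{1,2,\ldots\}$ appears exactly once, and rows and columns increase. An infinite semi-standard Young tableau $\hat{M}\in\operatorname{SSYT}(\hat{\lambda})$ consists of a semi-standard filling of the finite part by positive integers, together with a multiplicity $m_h\geq0$ for each integer $h>0$, with $m_h>0$ for only finitely many $h$ (one thinks of the first row as infinitely many zeros followed, at infinity, by $m_h$ copies of each $h$). $\operatorname{CCT}(\hat{\lambda})$ consists of those $\hat{C}\in\operatorname{SSYT}(\hat{\lambda})$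 such that every $h$ with $m_h>0$ appears in the finite part, and for every $h>0$ appearing in the finite part, either its leftmost instance there lies in a row below an instance of $h-1$ in the finite part, or $h-1$ has positive multiplicity, where $0$ is regarded as having (infinite) positive multiplicity. Limits. The limit of $\lambda,\lambda_+,(\lambda_+)_+,\ldots$ is the increasing union of diagrams. The limit of $T,\iota T,\iota^2T,\ldots$ is the increasing union of the fillings. The limit of $M,\hat{\iota}M,\hat{\iota}^2M,\ldots$ has as finite part the rows of $M$ below the first one (unchanged by $\hat{\iota}$), and $m_h$ is the number of times $h>0$ appears in the first row of $M$. *)

theory Defs
  imports Main
begin

text \<open>
  Cells are pairs (row, column), both counted from 0, with rows numbered downwards; so the
  first row of a diagram is row 0. The empty list is the unique partition of 0.
\<close>

type_synonym cell = "nat \<times> nat"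

definition is_partition :: "nat list \<Rightarrow> nat \<Rightarrow> bool" (infix \<open>\<turnstile>\<^sub>p\<close> 50) where
  "\<mu> \<turnstile>\<^sub>p n \<longleftrightarrow> sorted_wrt (\<ge>) \<mu> \<and> 0 \<notin> set \<mu> \<and> sum_list \<mu> = n"

definition diagram :: "nat list \<Rightarrow> cell set" where
  "diagram \<mu> = {(i, j). i < length \<mu> \<and> j < \<mu> ! i}"

fun add_box :: "nat list \<Rightarrow> nat list" where
  "add_box [] = [1]"
| "add_box (a # \<mu>) = Suc a # \<mu>"

definition ferrers :: "cell set \<Rightarrow> bool" where
  "ferrers D \<longleftrightarrow> (\<forall>i j i' j'. (i, j) \<in> D \<and> i' \<le> i \<and> j' \<le> j \<longrightarrow> (i', j') \<in> D)"

text \<open>The rows below the first one, renumbered so that they again start with row 0.\<close>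

definition finite_part :: "cell set \<Rightarrow> cell set" where
  "finite_part D = {(i, j). (Suc i, j) \<in> D}"

definition inf_ferrers :: "cell set \<Rightarrow> bool" where
  "inf_ferrers D \<longleftrightarrow>
     ferrers D \<and> infinite {j. (0, j) \<in> D} \<and> (\<exists>\<mu> n. \<mu> \<turnstile>\<^sub>p n \<and> finite_part D = diagram \<mu>)"

definition diagram_limit :: "nat list \<Rightarrow> cell set" where
  "diagram_limit \<mu> = (\<Union>k. diagram ((add_box ^^ k) \<mu>))"

text \<open>A tableau is a partial map whose domain is its shape.\<close>

type_synonym tableau = "cell \<rightharpoonup> nat"

definition standard_filling :: "cell set \<Rightarrow> nat set \<Rightarrow> tableau \<Rightarrow> bool" where
  "standard_filling D E T \<longleftrightarrow>
     dom T = D \<and> bij_betw (\<lambda>c. the (T c)) D E \<and>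
     (\<forall>i j j' a b. T (i, j) = Some a \<and> T (i, j') = Some b \<and> j < j' \<longrightarrow> a < b) \<and>
     (\<forall>i i' j a b. T (i, j) = Some a \<and> T (i', j) = Some b \<and> i < i' \<longrightarrow> a < b)"

definition semistandard_filling :: "cell set \<Rightarrow> tableau \<Rightarrow> bool" where
  "semistandard_filling D M \<longleftrightarrow>
     dom M = D \<and>
     (\<forall>i j j' a b. M (i, j) = Some a \<and> M (i, j') = Some b \<and> j < j' \<longrightarrow> a \<le> b) \<and>
     (\<forall>i i' j a b. M (i, j) = Some a \<and> M (i', j) = Some b \<and> i < i' \<longrightarrow> a < b)"

definition SYT :: "nat list \<Rightarrow> tableau set" where
  "SYT \<mu> = {T. standard_filling (diagram \<mu>) {1..sum_list \<mu>} T}"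

definition SSYT :: "nat list \<Rightarrow> tableau set" where
  "SSYT \<mu> = {M. semistandard_filling (diagram \<mu>) M}"

definition leftmost :: "tableau \<Rightarrow> nat \<Rightarrow> cell \<Rightarrow> bool" where
  "leftmost M h = (\<lambda>(i, j). M (i, j) = Some h \<and> (\<forall>i' j'. M (i', j') = Some h \<longrightarrow> j \<le> j'))"

definition CCT :: "nat list \<Rightarrow> tableau set" where
  "CCT \<mu> = {C \<in> SSYT \<mu>. \<forall>h>0. \<forall>i j. leftmost C h (i, j) \<longrightarrow>
      (\<exists>i'<i. \<exists>j'. C (i', j') = Some (h - 1))}"

text \<open>
  For a tableau of shape \<open>\<mu>\<close> with \<open>\<mu> \<turnstile>\<^sub>p n\<close>, the first argument of the update is the cell of
  \<open>add_box \<mu>\<close> that is not in \<open>\<mu>\<close>, and \<open>card (dom T)\<close> is \<open>n\<close>.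
\<close>

definition iota :: "tableau \<Rightarrow> tableau" where
  "iota T = T((0, card {j. (0, j) \<in> dom T}) \<mapsto> card (dom T) + 1)"

definition hat_iota :: "tableau \<Rightarrow> tableau" where
  "hat_iota M = (\<lambda>(i, j). if i = 0 then (case j of 0 \<Rightarrow> Some 0 | Suc j' \<Rightarrow> M (0, j')) else M (i, j))"

definition inf_SYT :: "cell set \<Rightarrow> tableau set" where
  "inf_SYT D = {T. standard_filling D {1..} T}"

text \<open>
  An infinite semi-standard tableau is a filling of the finite part together with the
  multiplicities \<open>m h\<close> for \<open>h > 0\<close>. The value \<open>m 0\<close> carries no information and is fixed to be 0;
  the infinite multiplicity of the entry 0 is accounted for separately in \<open>inf_CCT\<close>.
\<close>

type_synonym inf_tableau = "tableau \<times> (nat \<Rightarrow> nat)"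

definition inf_SSYT :: "cell set \<Rightarrow> inf_tableau set" where
  "inf_SSYT D = {(F, m). semistandard_filling (finite_part D) F \<and> 0 \<notin> ran F \<and>
      finite {h. m h > 0} \<and> m 0 = 0}"

definition inf_CCT :: "cell set \<Rightarrow> inf_tableau set" where
  "inf_CCT D = {(F, m). (F, m) \<in> inf_SSYT D \<and>
      (\<forall>h>0. m h > 0 \<longrightarrow> h \<in> ran F) \<and>
      (\<forall>h>0. \<forall>i j. leftmost F h (i, j) \<longrightarrow>
         (\<exists>i'<i. \<exists>j'. F (i', j') = Some (h - 1)) \<or> h - 1 = 0 \<or> m (h - 1) > 0)}"

definition is_SYT_limit :: "tableau \<Rightarrow> tableau \<Rightarrow> bool" where
  "is_SYT_limit T T' \<longleftrightarrow> Map.graph T' = (\<Union>k. Map.graph ((iota ^^ k) T))"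

definition below_first_row :: "tableau \<Rightarrow> tableau" where
  "below_first_row M = (\<lambda>(i, j). M (Suc i, j))"

definition first_row_mult :: "tableau \<Rightarrow> nat \<Rightarrow> nat" where
  "first_row_mult M h = (if h = 0 then 0 else card {j. M (0, j) = Some h})"

text \<open>
  The case \<open>k = 0\<close> determines the limit from \<open>M\<close>; the other cases say that these data do not
  change along the sequence of which it is the limit.
\<close>

definition is_SSYT_limit :: "tableau \<Rightarrow> inf_tableau \<Rightarrow> bool" where
  "is_SSYT_limit M = (\<lambda>(F, m). \<forall>k. below_first_row ((hat_iota ^^ k) M) = F \<and>
      first_row_mult ((hat_iota ^^ k) M) = m)"

end

theory Submission
  imports Defs
begin

text \<open>
  All three limits leave the rows below the first one alone, so each of them has a closed form
  that is determined by the first row and by the finite part.  The limit of \<open>\<mu>\<close> has a full first row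
  and \<open>tl \<mu>\<close> below it (\<open>Suc_mem_diagram_limit\<close>).  The limit of a standard tableau \<open>T\<close> with \<open>n\<close> cells
  and first row of length \<open>a\<close> continues the first row by \<open>n + 1, n + 2, \<dots>\<close> from column \<open>a\<close> on
  (\<open>is_SYT_limit_iff\<close>).  The limit of a semi-standard tableau consists of its lower rows and of the
  multiplicities in its first row (\<open>is_SSYT_limit_iff\<close>).  From these
  descriptions, the conditions on the limits follow cell by cell.

  Conversely, let \<open>T'\<close> be an infinite standard tableau and let \<open>N\<close> bound the entries of its finite
  part.  The cells with entries up to \<open>N\<close> form a finite Ferrers diagram that contains the
  finite part, and the entries above \<open>N\<close> all lie in the first row; since they increase and exhaust
  \<open>{N + 1, N + 2, \<dots>}\<close>, they are consecutive (\<open>strict_mono_range_greaterThan\<close>).  So \<open>T'\<close> is the limit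
  of its restriction to these cells (\<open>inf_SYT_is_limit\<close>).
  An infinite semi-standard tableau \<open>(F, m)\<close> is the limit of the tableau whose first row consists of
  sufficiently many zeros to cover the finite part, followed by \<open>m h\<close> copies of each \<open>h > 0\<close> in
  increasing order (\<open>inf_SSYT_is_limit\<close>).

  For cocharge tableaux, the point is that a leftmost instance of \<open>h\<close> in the finite part
  is also leftmost in the whole tableau: if an \<open>h\<close> of the first row had an \<open>h\<close> of a lower row weakly
  to its right, then the first row would contain, above the latter, an entry that is both at
  least and less than \<open>h\<close> (\<open>SSYT_lower_instance_left\<close>).
  An entry \<open>h - 1\<close> in the first row is accounted for by \<open>m (h - 1) > 0\<close> or by \<open>h - 1 = 0\<close>.
\<close>

section \<open>Diagrams and their limits\<close>

text \<open>The length of the first row, which is 0 for the empty partition.\<close>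

definition first_row :: "nat list \<Rightarrow> nat" where
  "first_row \<mu> = (case \<mu> of [] \<Rightarrow> 0 | a # _ \<Rightarrow> a)"

lemma first_row_simps [simp]: "first_row [] = 0" "first_row (a # \<mu>) = a"
  by (simp_all add: first_row_def)

lemma zero_mem_diagram [simp]: "(0, j) \<in> diagram \<mu> \<longleftrightarrow> j < first_row \<mu>"
  by (cases \<mu>) (auto simp: diagram_def)

lemma Suc_mem_diagram [simp]: "(Suc i, j) \<in> diagram \<mu> \<longleftrightarrow> (i, j) \<in> diagram (tl \<mu>)"
  by (cases \<mu>) (auto simp: diagram_def)

lemma diagram_Nil [simp]: "diagram [] = {}"
  by (auto simp: diagram_def)

lemma diagram_Cons: "diagram (a # \<mu>) = Pair 0 ` {..<a} \<union> (\<lambda>(i, j). (Suc i, j)) ` diagram \<mu>"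
proof -
  have "(i, j) \<in> diagram (a # \<mu>) \<longleftrightarrow>
    (i, j) \<in> Pair 0 ` {..<a} \<union> (\<lambda>(i, j). (Suc i, j)) ` diagram \<mu>" for i j
    by (cases i) force+
  then show ?thesis by auto
qed

lemma finite_diagram [simp]: "finite (diagram \<mu>)"
  by (induction \<mu>) (auto simp: diagram_Cons)

lemma card_diagram: "card (diagram \<mu>) = sum_list \<mu>"
proof (induction \<mu>)
  case (Cons a \<mu>)
  have "card (diagram (a # \<mu>)) =
      card (Pair (0::nat) ` {..<a}) + card ((\<lambda>(i, j). (Suc i, j)) ` diagram \<mu>)"
    unfolding diagram_Cons by (rule card_Un_disjoint) auto
  also have "\<dots> = a + card (diagram \<mu>)"
    by (simp add: card_image inj_on_def split_def prod_eq_iff)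
  finally show ?case using Cons by simp
qed simp

lemma ferrers_diagram:
  assumes "sorted_wrt (\<ge>) \<mu>"
  shows "ferrers (diagram \<mu>)"
  unfolding ferrers_def diagram_def
proof clarsimp
  fix i j i' j'
  assume h: "i < length \<mu>" "j < \<mu> ! i" "i' \<le> i" "j' \<le> j"
  have "\<mu> ! i \<le> \<mu> ! i'"
    using assms h by (cases "i' = i") (auto simp: sorted_wrt_iff_nth_less)
  then show "j' < \<mu> ! i'" using h by simp
qed

lemma partition_ferrers: "\<mu> \<turnstile>\<^sub>p n \<Longrightarrow> ferrers (diagram \<mu>)"
  by (simp add: is_partition_def ferrers_diagram)

lemma partition_tl: "\<mu> \<turnstile>\<^sub>p n \<Longrightarrow> tl \<mu> \<turnstile>\<^sub>p sum_list (tl \<mu>)"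
  by (cases \<mu>) (auto simp: is_partition_def)

lemma add_box_simps [simp]:
  "first_row (add_box \<mu>) = Suc (first_row \<mu>)"
  "tl (add_box \<mu>) = tl \<mu>"
  "sum_list (add_box \<mu>) = Suc (sum_list \<mu>)"
  by (cases \<mu>; simp)+

lemma add_box_funpow [simp]:
  "first_row ((add_box ^^ k) \<mu>) = first_row \<mu> + k"
  "tl ((add_box ^^ k) \<mu>) = tl \<mu>"
  "sum_list ((add_box ^^ k) \<mu>) = sum_list \<mu> + k"
  by (induction k) simp_all

lemma zero_mem_diagram_limit [simp]: "(0, j) \<in> diagram_limit \<mu>"
  unfolding diagram_limit_def by (auto intro: exI[of _ "Suc j"])

lemma Suc_mem_diagram_limit [simp]: "(Suc i, j) \<in> diagram_limit \<mu> \<longleftrightarrow> (i, j) \<in> diagram (tl \<mu>)"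
  unfolding diagram_limit_def by simp

lemma finite_part_diagram_limit [simp]: "finite_part (diagram_limit \<mu>) = diagram (tl \<mu>)"
  unfolding finite_part_def by simp

lemma diagram_subset_limit: "diagram \<mu> \<subseteq> diagram_limit \<mu>"
  unfolding diagram_limit_def using UN_upper[of 0 UNIV "\<lambda>k. diagram ((add_box ^^ k) \<mu>)"] by simp

lemma inf_ferrers_diagram_limit:
  assumes "\<mu> \<turnstile>\<^sub>p n"
  shows "inf_ferrers (diagram_limit \<mu>)"
  unfolding inf_ferrers_def
proof (intro conjI)
  have fer: "ferrers (diagram (tl \<mu>))"
    using partition_ferrers partition_tl assms by blast
  show "ferrers (diagram_limit \<mu>)"
    unfolding ferrers_def
  proof (intro allI impI, elim conjE)
    fix i j i' j'
    assume h: "(i, j) \<in> diagram_limit \<mu>" "i' \<le> i" "j' \<le> j"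
    show "(i', j') \<in> diagram_limit \<mu>"
    proof (cases i')
      case (Suc k)
      then obtain l where "i = Suc l" "k \<le> l" using h by (cases i) auto
      then show ?thesis using h fer Suc unfolding ferrers_def by auto
    qed simp
  qed
  show "infinite {j. (0, j) \<in> diagram_limit \<mu>}" by simp
  show "\<exists>\<nu> m. \<nu> \<turnstile>\<^sub>p m \<and> finite_part (diagram_limit \<mu>) = diagram \<nu>"
    using partition_tl[OF assms] by auto
qed

lemma inf_ferrers_zero_mem:
  assumes "inf_ferrers D"
  shows "(0, j) \<in> D"
proof -
  have "\<not> {k. (0, k) \<in> D} \<subseteq> {..<j}"
    using assms finite_subset[of _ "{..<j}"] unfolding inf_ferrers_def by blast
  then obtain k where "j \<le> k" "(0, k) \<in> D" by (auto simp: subset_iff not_less)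
  then show ?thesis using assms unfolding inf_ferrers_def ferrers_def by blast
qed

lemma inf_ferrers_eq_diagram_limit:
  assumes "inf_ferrers D" "finite_part D = diagram (tl \<mu>)"
  shows "diagram_limit \<mu> = D"
proof -
  have "(i, j) \<in> diagram_limit \<mu> \<longleftrightarrow> (i, j) \<in> D" for i j
  proof (cases i)
    case 0
    then show ?thesis using inf_ferrers_zero_mem[OF assms(1)] by simp
  next
    case (Suc k)
    have "(Suc k, j) \<in> D \<longleftrightarrow> (k, j) \<in> finite_part D" by (simp add: finite_part_def)
    then show ?thesis using assms(2) Suc by simp
  qed
  then show ?thesis by auto
qed

lemma partition_prepend:
  assumes "\<nu> \<turnstile>\<^sub>p m" "first_row \<nu> \<le> a"
  obtains \<mu> where "\<mu> \<turnstile>\<^sub>p a + m" "first_row \<mu> = a" "tl \<mu> = \<nu>"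
proof (cases "a = 0")
  case True
  \<comment> \<open>Parts are positive, so a partition with an empty first row is empty.\<close>
  then have "\<nu> = []" using assms by (cases \<nu>) (auto simp: is_partition_def)
  then show ?thesis using that[of "[]"] assms True by simp
next
  case False
  have "\<forall>x\<in>set \<nu>. x \<le> first_row \<nu>"
    using assms(1) by (cases \<nu>) (auto simp: is_partition_def)
  then have "a # \<nu> \<turnstile>\<^sub>p a + m" using assms False by (auto simp: is_partition_def)
  then show ?thesis using that[of "a # \<nu>"] by simp
qed

lemma inf_ferrers_obtain:
  assumes "inf_ferrers D"
  obtains \<nu> m where "\<nu> \<turnstile>\<^sub>p m" "finite_part D = diagram \<nu>"
  using assms unfolding inf_ferrers_def by blast

lemma inf_ferrers_is_limit:
  assumes "inf_ferrers D"
  shows "\<exists>n \<mu>. \<mu> \<turnstile>\<^sub>p n \<and> diagram_limit \<mu> = D"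
proof -
  obtain \<nu> m where \<nu>: "\<nu> \<turnstile>\<^sub>p m" "finite_part D = diagram \<nu>"
    using assms by (rule inf_ferrers_obtain)
  obtain \<mu> where "\<mu> \<turnstile>\<^sub>p first_row \<nu> + m" "tl \<mu> = \<nu>"
    using partition_prepend[OF \<nu>(1) order_refl] by blast
  then show ?thesis using inf_ferrers_eq_diagram_limit[OF assms] \<nu>(2) by blast
qed

section \<open>Limits of standard tableaux\<close>

text \<open>
  The tableau obtained from \<open>T\<close> by filling row 0 from column \<open>a\<close> on with the entries
  \<open>n + 1, n + 2, \<dots>\<close>.
\<close>

definition continue_row :: "nat \<Rightarrow> nat \<Rightarrow> tableau \<Rightarrow> tableau" where
  "continue_row a n T = (\<lambda>(i, j). if i = 0 \<and> a \<le> j then Some (Suc (n + (j - a))) else T (i, j))"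

lemma iota_power:
  assumes "dom T = diagram \<mu>"
  shows "(iota ^^ k) T = continue_row (first_row \<mu>) (sum_list \<mu>) T |` diagram ((add_box ^^ k) \<mu>)"
proof (induction k)
  case 0
  show ?case
  proof
    fix c :: cell
    show "(iota ^^ 0) T c =
      (continue_row (first_row \<mu>) (sum_list \<mu>) T |` diagram ((add_box ^^ 0) \<mu>)) c"
    proof (cases "c \<in> diagram \<mu>")
      case True
      then show ?thesis by (cases c) (auto simp: continue_row_def)
    next
      case False
      then have "T c = None" using assms by (metis domIff)
      then show ?thesis using False by simp
    qed
  qed
next
  case (Suc k)
  let ?T = "continue_row (first_row \<mu>) (sum_list \<mu>) T"
  let ?D = "\<lambda>k. diagram ((add_box ^^ k) \<mu>)"
  have dm: "dom (?T |` ?D k) = ?D k"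
  proof -
    have "?T c \<noteq> None" if "c \<in> ?D k" for c
    proof -
      obtain i j where c: "c = (i, j)" by (cases c)
      have "(i, j) \<in> diagram \<mu>" if "\<not> (i = 0 \<and> first_row \<mu> \<le> j)"
        using \<open>c \<in> ?D k\<close> c that by (cases i) auto
      then show ?thesis using assms c by (auto simp: continue_row_def dom_def)
    qed
    then show ?thesis by (auto simp: dom_def restrict_map_def)
  qed
  have D: "?D (Suc k) = insert (0, first_row \<mu> + k) (?D k)"
  proof -
    have "(i, j) \<in> ?D (Suc k) \<longleftrightarrow> (i, j) \<in> insert (0, first_row \<mu> + k) (?D k)" for i j
      by (cases i) auto
    then show ?thesis by auto
  qed
  have "(iota ^^ Suc k) T = iota (?T |` ?D k)" using Suc by simp
  also have "\<dots> = (?T |` ?D k)((0, first_row \<mu> + k) \<mapsto> Suc (sum_list \<mu> + k))"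
    unfolding iota_def dm by (simp add: card_diagram)
  also have "\<dots> = ?T |` ?D (Suc k)"
    unfolding D by (auto simp: fun_eq_iff restrict_map_def continue_row_def)
  finally show ?case .
qed

lemma dom_continue_row:
  assumes "dom T = diagram \<mu>"
  shows "dom (continue_row (first_row \<mu>) n T) = diagram_limit \<mu>"
proof -
  have "(i, j) \<in> dom (continue_row (first_row \<mu>) n T) \<longleftrightarrow> (i, j) \<in> diagram_limit \<mu>" for i j
  proof -
    have "T (i, j) \<noteq> None \<longleftrightarrow> (i, j) \<in> diagram \<mu>" using assms by auto
    then show ?thesis by (cases i) (auto simp: continue_row_def)
  qed
  then show ?thesis by auto
qed

lemma is_SYT_limit_iff:
  assumes "dom T = diagram \<mu>"
  shows "is_SYT_limit T T' \<longleftrightarrow> T' = continue_row (first_row \<mu>) (sum_list \<mu>) T"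
proof -
  let ?T = "continue_row (first_row \<mu>) (sum_list \<mu>) T"
  have "(\<Union>k. Map.graph ((iota ^^ k) T)) = Map.graph ?T"
  proof -
    have "(c, v) \<in> (\<Union>k. Map.graph ((iota ^^ k) T)) \<longleftrightarrow> (c, v) \<in> Map.graph ?T" for c v
    proof -
      have "(c, v) \<in> Map.graph (f |` A) \<longleftrightarrow> c \<in> A \<and> f c = Some v" for f A
        by (cases c) (auto simp: Map.graph_def restrict_map_def split: if_splits)
      then have "(c, v) \<in> (\<Union>k. Map.graph ((iota ^^ k) T)) \<longleftrightarrow> c \<in> diagram_limit \<mu> \<and> ?T c = Some v"
        unfolding iota_power[OF assms] diagram_limit_def by blast
      moreover have "?T c = Some v \<Longrightarrow> c \<in> diagram_limit \<mu>"
        using dom_continue_row[OF assms] by auto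
      ultimately show ?thesis by (auto simp: Map.graph_def)
    qed
    then show ?thesis by auto
  qed
  moreover have "Map.graph T' = Map.graph ?T \<longleftrightarrow> T' = ?T"
  proof
    assume "Map.graph T' = Map.graph ?T"
    then have "T' c = Some v \<longleftrightarrow> ?T c = Some v" for c v
      by (cases c) (auto simp: Map.graph_def set_eq_iff)
    then show "T' = ?T" by (intro ext) (metis option.exhaust)
  qed simp
  ultimately show ?thesis by (simp add: is_SYT_limit_def)
qed

lemma continue_row_inf_SYT:
  assumes "\<mu> \<turnstile>\<^sub>p n" "T \<in> SYT \<mu>"
  shows "continue_row (first_row \<mu>) n T \<in> inf_SYT (diagram_limit \<mu>)"
proof -
  let ?a = "first_row \<mu>"
  let ?T = "continue_row ?a n T"
  let ?R = "Pair (0::nat) ` {?a..}"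
  have n: "sum_list \<mu> = n" using assms(1) by (simp add: is_partition_def)
  have T: "dom T = diagram \<mu>" "bij_betw (\<lambda>c. the (T c)) (diagram \<mu>) {1..n}"
    "\<And>i j j' a b. T (i, j) = Some a \<Longrightarrow> T (i, j') = Some b \<Longrightarrow> j < j' \<Longrightarrow> a < b"
    "\<And>i i' j a b. T (i, j) = Some a \<Longrightarrow> T (i', j) = Some b \<Longrightarrow> i < i' \<Longrightarrow> a < b"
    using assms(2) n unfolding SYT_def standard_filling_def by blast+
  have le: "v \<le> n" if "T c = Some v" for c v
    using that T(1,2) unfolding bij_betw_def by force
  have inD: "c \<in> diagram \<mu>" if "T c = Some v" for c v
    using that T(1) by blast
  have dom: "dom ?T = diagram_limit \<mu>" by (rule dom_continue_row[OF T(1)])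
  have split: "diagram_limit \<mu> = diagram \<mu> \<union> ?R"
  proof -
    have "(i, j) \<in> diagram_limit \<mu> \<longleftrightarrow> (i, j) \<in> diagram \<mu> \<union> ?R" for i j
      by (cases i) auto
    then show ?thesis by auto
  qed
  have "bij_betw (\<lambda>c. the (?T c)) (diagram \<mu>) {1..n}"
    using T(2) by (rule bij_betw_cong[THEN iffD1, rotated]) (auto simp: continue_row_def)
  moreover have "bij_betw (\<lambda>c. the (?T c)) ?R {n<..}"
    unfolding bij_betw_def
  proof
    show "inj_on (\<lambda>c. the (?T c)) ?R" by (auto simp: inj_on_def continue_row_def)
    have "v \<in> (\<lambda>c. the (?T c)) ` ?R" if "n < v" for v
      using that by (intro image_eqI[of _ _ "(0, ?a + (v - Suc n))"]) (auto simp: continue_row_def)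
    then show "(\<lambda>c. the (?T c)) ` ?R = {n<..}" by (auto simp: continue_row_def)
  qed
  ultimately have "bij_betw (\<lambda>c. the (?T c)) (diagram \<mu> \<union> ?R) ({1..n} \<union> {n<..})"
    by (rule bij_betw_combine) auto
  moreover have "{1..n} \<union> {n<..} = {1..}" by auto
  ultimately have bij: "bij_betw (\<lambda>c. the (?T c)) (diagram_limit \<mu>) {1..}"
    using split by simp
  have row: "u < v" if "?T (i, j) = Some u" "?T (i, j') = Some v" "j < j'" for i j j' u v
    using that T(3)[of i j u j' v] le[of "(i, j)" u]
    by (auto simp: continue_row_def split: if_splits)
  have col: "u < v" if h: "?T (i, j) = Some u" "?T (i', j) = Some v" "i < i'" for i i' j u v
  proof -
    have v: "T (i', j) = Some v" using h by (auto simp: continue_row_def)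
    have "(0, j) \<in> diagram \<mu>"
      using inD[OF v] partition_ferrers[OF assms(1)] unfolding ferrers_def by blast
    then have "T (i, j) = Some u" using h by (auto simp: continue_row_def split: if_splits)
    then show ?thesis using T(4) v h(3) by blast
  qed
  show ?thesis
    unfolding inf_SYT_def standard_filling_def using dom bij row col by blast
qed

text \<open>
  This applies to the part of the first row of an infinite standard tableau that holds the
  entries beyond \<open>n\<close>, when all other cells have entries up to \<open>n\<close>.
\<close>

lemma strict_mono_range_greaterThan:
  fixes f :: "nat \<Rightarrow> nat"
  assumes "strict_mono f" "range f = {n<..}"
  shows "f k = Suc (n + k)"
proof (rule antisym)
  show "Suc (n + k) \<le> f k"
  proof (induction k)
    case 0
    have "f 0 \<in> {n<..}" using assms(2) by blast
    then show ?case by simp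
  next
    case (Suc k)
    have "f k < f (Suc k)" using assms(1) by (simp add: strict_mono_less)
    then show ?case using Suc by simp
  qed
  have "{n<..<f k} \<subseteq> f ` {..<k}"
  proof
    fix v assume v: "v \<in> {n<..<f k}"
    then have "v \<in> range f" using assms(2) by simp
    then obtain l where "v = f l" by blast
    then show "v \<in> f ` {..<k}" using v assms(1) by (simp add: strict_mono_less)
  qed
  then have "card {n<..<f k} \<le> card (f ` {..<k})" by (intro card_mono) auto
  also have "\<dots> \<le> k" using card_image_le[of "{..<k}" f] by simp
  finally show "f k \<le> Suc (n + k)" by simp
qed

lemma inf_SYT_is_limit:
  assumes "inf_ferrers D" "T' \<in> inf_SYT D"
  shows "\<exists>n \<mu> T. \<mu> \<turnstile>\<^sub>p n \<and> T \<in> SYT \<mu> \<and> diagram_limit \<mu> = D \<and> is_SYT_limit T T'"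
proof -
  have T': "dom T' = D" "bij_betw (\<lambda>c. the (T' c)) D {1..}"
    "\<And>i j j' a b. T' (i, j) = Some a \<Longrightarrow> T' (i, j') = Some b \<Longrightarrow> j < j' \<Longrightarrow> a < b"
    "\<And>i i' j a b. T' (i, j) = Some a \<Longrightarrow> T' (i', j) = Some b \<Longrightarrow> i < i' \<Longrightarrow> a < b"
    using assms(2) unfolding inf_SYT_def standard_filling_def by blast+
  obtain \<nu> m where \<nu>: "\<nu> \<turnstile>\<^sub>p m" "finite_part D = diagram \<nu>"
    using assms(1) by (rule inf_ferrers_obtain)
  have low: "(Suc i, j) \<in> D \<longleftrightarrow> (i, j) \<in> diagram \<nu>" for i j
    using \<nu>(2) by (auto simp: finite_part_def)
  have "finite ((\<lambda>(i, j). the (T' (Suc i, j))) ` diagram \<nu>)" by simp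
  then obtain N where "\<forall>v \<in> (\<lambda>(i, j). the (T' (Suc i, j))) ` diagram \<nu>. v \<le> N"
    unfolding finite_nat_set_iff_bounded_le by blast
  then have N: "the (T' (Suc i, j)) \<le> N" if "(i, j) \<in> diagram \<nu>" for i j
    using that by force
  define f where "f j = the (T' (0, j))" for j
  have f: "T' (0, j) = Some (f j)" for j
    using inf_ferrers_zero_mem[OF assms(1), of j] T'(1) unfolding f_def by auto
  have mono: "strict_mono f" using T'(3)[OF f f] by (simp add: strict_mono_def)
  \<comment> \<open>Columns \<open>0, \<dots>, a - 1\<close> of the first row hold its entries up to \<open>N\<close>.\<close>
  define a where "a = (LEAST j. N < f j)"
  have "N < f (Suc N)"
    using strict_mono_imp_increasing[OF mono, of "Suc N"] by simp
  then have "N < f a" unfolding a_def by (rule LeastI)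
  have fa: "f j \<le> N \<longleftrightarrow> j < a" for j
  proof
    assume "j < a"
    then show "f j \<le> N" unfolding a_def using not_less_Least by force
  next
    assume "f j \<le> N"
    then have "f j < f a" using \<open>N < f a\<close> by simp
    then show "j < a" using mono by (simp add: strict_mono_less)
  qed
  have "first_row \<nu> \<le> a"
  proof (rule ccontr)
    assume "\<not> first_row \<nu> \<le> a"
    then have mem: "(0, a) \<in> diagram \<nu>" by simp
    then obtain v where v: "T' (Suc 0, a) = Some v" using low T'(1) by blast
    then have "f a < v" using T'(4)[OF f] by simp
    moreover have "v \<le> N" using N[OF mem] v by simp
    ultimately show False using \<open>N < f a\<close> by simp
  qed
  then obtain \<mu> where \<mu>: "\<mu> \<turnstile>\<^sub>p a + m" "first_row \<mu> = a" "tl \<mu> = \<nu>"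
    using partition_prepend[OF \<nu>(1)] by blast
  have lim: "diagram_limit \<mu> = D"
    using inf_ferrers_eq_diagram_limit assms(1) \<nu>(2) \<mu>(3) by simp
  then have sub: "diagram \<mu> \<subseteq> D" using diagram_subset_limit by blast
  have mem_iff: "c \<in> diagram \<mu> \<longleftrightarrow> c \<in> D \<and> the (T' c) \<le> N" for c
  proof -
    obtain i j where c: "c = (i, j)" by (cases c)
    show ?thesis
    proof (cases i)
      case 0
      then show ?thesis using c fa \<mu>(2) f inf_ferrers_zero_mem[OF assms(1)] by simp
    next
      case (Suc k)
      then show ?thesis using c \<mu>(3) low N by auto
    qed
  qed
  have "(\<lambda>c. the (T' c)) ` diagram \<mu> = {1..N}"
  proof -
    have "(\<lambda>c. the (T' c)) ` D = {1..}" using T'(2) by (simp add: bij_betw_def)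
    moreover have "(\<lambda>c. the (T' c)) ` {c \<in> D. the (T' c) \<le> N} =
        {v \<in> (\<lambda>c. the (T' c)) ` D. v \<le> N}"
      by (rule Compr_image_eq[symmetric])
    moreover have "diagram \<mu> = {c \<in> D. the (T' c) \<le> N}" using mem_iff by blast
    ultimately show ?thesis by auto
  qed
  then have bij: "bij_betw (\<lambda>c. the (T' c)) (diagram \<mu>) {1..N}"
    using T'(2) sub by (auto simp: bij_betw_def intro: inj_on_subset)
  then have sum: "sum_list \<mu> = N"
    using bij_betw_same_card[OF bij] by (simp add: card_diagram)
  define T where "T = T' |` diagram \<mu>"
  have dom: "dom T = diagram \<mu>" using T'(1) sub by (auto simp: T_def)
  have Teq: "T' c = Some v" if "T c = Some v" for c v
    using that by (auto simp: T_def restrict_map_def split: if_splits)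
  have "bij_betw (\<lambda>c. the (T c)) (diagram \<mu>) {1..N}"
    using bij by (rule bij_betw_cong[THEN iffD1, rotated]) (simp add: T_def)
  then have SYT: "T \<in> SYT \<mu>"
    unfolding SYT_def standard_filling_def sum using dom Teq T'(3,4) by blast
  have rng: "range (\<lambda>k. f (a + k)) = {N<..}"
  proof
    have "N < f (a + k)" for k using fa[of "a + k"] by simp
    then show "range (\<lambda>k. f (a + k)) \<subseteq> {N<..}" by blast
    show "{N<..} \<subseteq> range (\<lambda>k. f (a + k))"
    proof
      fix v assume v: "v \<in> {N<..}"
      then have "v \<in> (\<lambda>c. the (T' c)) ` D" using T'(2) by (simp add: bij_betw_def)
      then obtain i j where ij: "(i, j) \<in> D" "v = the (T' (i, j))" by auto
      have "i = 0"
      proof (cases i)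
        case (Suc k)
        then show ?thesis using ij low N[of k j] v by auto
      qed
      then have "v = f j" using ij f by simp
      moreover from this have "a \<le> j" using fa[of j] v by simp
      ultimately show "v \<in> range (\<lambda>k. f (a + k))" by (intro image_eqI[of _ _ "j - a"]) auto
    qed
  qed
  have "strict_mono (\<lambda>k. f (a + k))" using mono by (simp add: strict_mono_def)
  then have tail: "f (a + k) = Suc (N + k)" for k
    using rng by (rule strict_mono_range_greaterThan)
  have "T' = continue_row (first_row \<mu>) (sum_list \<mu>) T"
  proof
    fix c :: cell
    obtain i j where c: "c = (i, j)" by (cases c)
    show "T' c = continue_row (first_row \<mu>) (sum_list \<mu>) T c"
    proof (cases "i = 0 \<and> a \<le> j")
      case True
      then show ?thesis using c f[of j] tail[of "j - a"] sum \<mu>(2) by (simp add: continue_row_def)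
    next
      case False
      then have "c \<in> diagram \<mu> \<longleftrightarrow> c \<in> D" 
        using c \<mu>(2,3) low inf_ferrers_zero_mem[OF assms(1)] by (cases i) auto
      moreover have "c \<notin> D \<Longrightarrow> T' c = None" using T'(1) by blast
      ultimately have "T' c = T c" by (auto simp: T_def restrict_map_def)
      then show ?thesis using False c \<mu>(2) by (auto simp: continue_row_def)
    qed
  qed
  then have "is_SYT_limit T T'" using is_SYT_limit_iff[OF dom] by simp
  then show ?thesis using \<mu>(1) SYT lim by blast
qed

section \<open>Limits of semi-standard tableaux\<close>

lemma below_first_row_hat_iota: "below_first_row ((hat_iota ^^ k) M) = below_first_row M"
  by (induction k) (auto simp: below_first_row_def hat_iota_def fun_eq_iff)

lemma first_row_mult_hat_iota: "first_row_mult ((hat_iota ^^ k) M) = first_row_mult M"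
proof -
  have "first_row_mult (hat_iota M) h = first_row_mult M h" for M h
  proof (cases "h = 0")
    case False
    then have "{j. hat_iota M (0, j) = Some h} = Suc ` {j. M (0, j) = Some h}"
      by (auto simp: hat_iota_def image_iff gr0_conv_Suc split: nat.splits)
    then show ?thesis by (simp add: first_row_mult_def card_image)
  qed (simp add: first_row_mult_def)
  then have "first_row_mult (hat_iota M) = first_row_mult M" for M by blast
  then show ?thesis by (induction k) auto
qed

lemma is_SSYT_limit_iff:
  "is_SSYT_limit M M' \<longleftrightarrow> M' = (below_first_row M, first_row_mult M)"
  unfolding is_SSYT_limit_def below_first_row_hat_iota first_row_mult_hat_iota by auto

lemma below_first_row_apply [simp]: "below_first_row M (i, j) = M (Suc i, j)"
  by (simp add: below_first_row_def)

lemma SSYT_D: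
  assumes "M \<in> SSYT \<mu>"
  shows "dom M = diagram \<mu>"
    "\<And>i j j' a b. M (i, j) = Some a \<Longrightarrow> M (i, j') = Some b \<Longrightarrow> j < j' \<Longrightarrow> a \<le> b"
    "\<And>i i' j a b. M (i, j) = Some a \<Longrightarrow> M (i', j) = Some b \<Longrightarrow> i < i' \<Longrightarrow> a < b"
  using assms unfolding SSYT_def semistandard_filling_def by blast+

lemma SSYT_above:
  assumes "\<mu> \<turnstile>\<^sub>p n" "M \<in> SSYT \<mu>" "M (Suc i, j) = Some v"
  obtains u where "M (0, j) = Some u" "u < v"
proof -
  have "(Suc i, j) \<in> diagram \<mu>" using assms SSYT_D(1) by blast
  then have "(0, j) \<in> diagram \<mu>"
    using partition_ferrers[OF assms(1)] unfolding ferrers_def by blast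
  then obtain u where "M (0, j) = Some u" using SSYT_D(1)[OF assms(2)] by blast
  moreover from this have "u < v" using SSYT_D(3)[OF assms(2)] assms(3) by blast
  ultimately show ?thesis using that by blast
qed

lemma finite_first_row:
  assumes "M \<in> SSYT \<mu>"
  shows "finite {j. M (0, j) = Some h}"
proof (rule finite_subset)
  show "{j. M (0, j) = Some h} \<subseteq> {..<first_row \<mu>}"
  proof
    fix j assume "j \<in> {j. M (0, j) = Some h}"
    then have "(0, j) \<in> diagram \<mu>" using SSYT_D(1)[OF assms] by blast
    then show "j \<in> {..<first_row \<mu>}" by simp
  qed
qed simp

lemma first_row_mult_pos_iff:
  assumes "M \<in> SSYT \<mu>" "h > 0"
  shows "first_row_mult M h > 0 \<longleftrightarrow> (\<exists>j. M (0, j) = Some h)"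
  using assms finite_first_row[OF assms(1)] by (auto simp: first_row_mult_def card_gt_0_iff)

lemma limit_in_inf_SSYT:
  assumes "\<mu> \<turnstile>\<^sub>p n" "M \<in> SSYT \<mu>"
  shows "(below_first_row M, first_row_mult M) \<in> inf_SSYT (diagram_limit \<mu>)"
proof -
  have "(i, j) \<in> dom (below_first_row M) \<longleftrightarrow> (i, j) \<in> diagram (tl \<mu>)" for i j
  proof -
    have "(i, j) \<in> dom (below_first_row M) \<longleftrightarrow> (Suc i, j) \<in> dom M" by (simp add: dom_def)
    then show ?thesis using SSYT_D(1)[OF assms(2)] by simp
  qed
  then have "dom (below_first_row M) = diagram (tl \<mu>)" by auto
  moreover have "\<forall>i j j' a b. below_first_row M (i, j) = Some a \<and>
      below_first_row M (i, j') = Some b \<and> j < j' \<longrightarrow> a \<le> b"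
    using SSYT_D(2)[OF assms(2)] by auto
  moreover have "\<forall>i i' j a b. below_first_row M (i, j) = Some a \<and>
      below_first_row M (i', j) = Some b \<and> i < i' \<longrightarrow> a < b"
    using SSYT_D(3)[OF assms(2)] by (auto dest: Suc_mono)
  ultimately have sem: "semistandard_filling (finite_part (diagram_limit \<mu>)) (below_first_row M)"
    unfolding semistandard_filling_def by simp
  have nz: "0 \<notin> ran (below_first_row M)"
  proof
    assume "0 \<in> ran (below_first_row M)"
    then obtain i j where "M (Suc i, j) = Some 0" by (auto simp: ran_def)
    then show False using SSYT_above[OF assms] by blast
  qed
  have "{h. first_row_mult M h > 0} \<subseteq> (\<lambda>c. the (M c)) ` diagram \<mu>"
  proof
    fix h assume h: "h \<in> {h. first_row_mult M h > 0}"
    then have "h > 0" by (auto simp: first_row_mult_def split: if_splits)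
    then obtain j where j: "M (0, j) = Some h"
      using h first_row_mult_pos_iff[OF assms(2)] by auto
    then have "(0, j) \<in> diagram \<mu>" using SSYT_D(1)[OF assms(2)] by blast
    then show "h \<in> (\<lambda>c. the (M c)) ` diagram \<mu>"
      using j by (intro image_eqI[of _ _ "(0, j)"]) simp_all
  qed
  then have "finite {h. first_row_mult M h > 0}" by (rule finite_subset) simp
  then show ?thesis using sem nz by (simp add: inf_SSYT_def first_row_mult_def)
qed

text \<open>A sorted first row with any number of zeros and prescribed multiplicities of positive entries.\<close>

lemma sorted_list_with_multiplicities:
  fixes m :: "nat \<Rightarrow> nat"
  assumes "finite {h. m h > 0}" "m 0 = 0"
  obtains L where "sorted L" "\<And>h. count_list L h = (if h = 0 then z else m h)"
proof -
  obtain B where B: "m h > 0 \<Longrightarrow> h < B" for h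
    using assms(1) unfolding finite_nat_set_iff_bounded by auto
  have "\<exists>L. sorted L \<and> set L \<subseteq> {..B} \<and>
      (\<forall>h. count_list L h = (if h = 0 then z else if h \<le> B then m h else 0))" for B
  proof (induction B)
    case 0
    have "count_list (replicate z 0) h = (if h = 0 then z else 0)" for h :: nat
      by (induction z) auto
    then show ?case by (intro exI[of _ "replicate z 0"]) auto
  next
    case (Suc B)
    then obtain L where L: "sorted L" "set L \<subseteq> {..B}"
      "\<And>h. count_list L h = (if h = 0 then z else if h \<le> B then m h else 0)" by blast
    have rep: "count_list (replicate k (Suc B)) h = (if h = Suc B then k else 0)" for h k
      by (induction k) auto
    let ?L = "L @ replicate (m (Suc B)) (Suc B)"
    have "sorted ?L" using L(1,2) by (auto simp: sorted_append)
    moreover have "set ?L \<subseteq> {..Suc B}" using L(2) by auto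
    moreover have "count_list ?L h = (if h = 0 then z else if h \<le> Suc B then m h else 0)" for h
      using L(3)[of h] rep[of _ h] by auto
    ultimately show ?case by blast
  qed
  then obtain L where L: "sorted L"
    "\<And>h. count_list L h = (if h = 0 then z else if h \<le> B then m h else 0)" by blast
  have "count_list L h = (if h = 0 then z else m h)" for h
    using L(2)[of h] B[of h] by (cases "m h = 0") auto
  then show ?thesis using that L(1) by blast
qed

lemma count_list_eq_card: "count_list L h = card {j. j < length L \<and> L ! j = h}"
  by (simp add: count_list_eq_length_filter length_filter_conv_card eq_commute[of h])

lemma sorted_count_zero:
  assumes "sorted (L :: nat list)" "j < count_list L 0"
  shows "j < length L" "L ! j = 0"
proof -
  show len: "j < length L" using assms(2) count_le_length[of L 0] by simp
  show "L ! j = 0"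
  proof (rule ccontr)
    assume "L ! j \<noteq> 0"
    have "{k. k < length L \<and> L ! k = 0} \<subseteq> {..<j}"
    proof
      fix k assume k: "k \<in> {k. k < length L \<and> L ! k = 0}"
      then have "\<not> j \<le> k" using sorted_nth_mono[OF assms(1), of j k] \<open>L ! j \<noteq> 0\<close> by auto
      then show "k \<in> {..<j}" by simp
    qed
    then have "count_list L 0 \<le> j"
      unfolding count_list_eq_card using card_mono[of "{..<j}"] by force
    then show False using assms(2) by simp
  qed
qed

lemma inf_SSYT_is_limit:
  assumes "inf_ferrers D" "M' \<in> inf_SSYT D"
  shows "\<exists>n \<mu> M. \<mu> \<turnstile>\<^sub>p n \<and> M \<in> SSYT \<mu> \<and> diagram_limit \<mu> = D \<and> is_SSYT_limit M M'"
proof -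
  obtain F m where M': "M' = (F, m)" by (cases M')
  obtain \<nu> s where \<nu>: "\<nu> \<turnstile>\<^sub>p s" "finite_part D = diagram \<nu>"
    using assms(1) by (rule inf_ferrers_obtain)
  have F: "dom F = diagram \<nu>"
    "\<And>i j j' a b. F (i, j) = Some a \<Longrightarrow> F (i, j') = Some b \<Longrightarrow> j < j' \<Longrightarrow> a \<le> b"
    "\<And>i i' j a b. F (i, j) = Some a \<Longrightarrow> F (i', j) = Some b \<Longrightarrow> i < i' \<Longrightarrow> a < b"
    "0 \<notin> ran F" "finite {h. m h > 0}" "m 0 = 0"
    using assms(2) \<nu>(2) unfolding M' inf_SSYT_def semistandard_filling_def by auto
  \<comment> \<open>One zero above each column of the finite part makes the columns strict.\<close>
  obtain L where L: "sorted L" "\<And>h. count_list L h = (if h = 0 then first_row \<nu> else m h)"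
    using sorted_list_with_multiplicities[OF F(5,6)] by blast
  have zero: "j < length L" "L ! j = 0" if "j < first_row \<nu>" for j
    using sorted_count_zero[OF L(1)] L(2)[of 0] that by auto
  have "first_row \<nu> \<le> length L" using L(2)[of 0] count_le_length[of L 0] by simp
  then obtain \<mu> where \<mu>: "\<mu> \<turnstile>\<^sub>p length L + s" "first_row \<mu> = length L" "tl \<mu> = \<nu>"
    using partition_prepend[OF \<nu>(1)] by blast
  have lim: "diagram_limit \<mu> = D"
    using inf_ferrers_eq_diagram_limit assms(1) \<nu>(2) \<mu>(3) by simp
  define M :: tableau where
    "M = (\<lambda>(i, j). case i of 0 \<Rightarrow> if j < length L then Some (L ! j) else None | Suc k \<Rightarrow> F (k, j))"
  have M0: "M (0, j) = (if j < length L then Some (L ! j) else None)" for j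
    by (simp add: M_def)
  have MS: "M (Suc k, j) = F (k, j)" for k j
    by (simp add: M_def)
  have "(i, j) \<in> dom M \<longleftrightarrow> (i, j) \<in> diagram \<mu>" for i j
  proof (cases i)
    case 0
    then show ?thesis by (simp add: dom_def M0 \<mu>(2))
  next
    case (Suc k)
    have "F (k, j) \<noteq> None \<longleftrightarrow> (k, j) \<in> diagram \<nu>" using F(1) by auto
    then show ?thesis by (simp add: dom_def Suc MS \<mu>(3))
  qed
  then have dom: "dom M = diagram \<mu>" by auto
  have row: "a \<le> b" if h: "M (i, j) = Some a" "M (i, j') = Some b" "j < j'" for i j j' a b
  proof (cases i)
    case 0
    then show ?thesis using h sorted_nth_mono[OF L(1), of j j'] by (auto simp: M0 split: if_splits)
  next
    case (Suc k)
    then show ?thesis using h F(2) by (simp add: MS)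
  qed
  have col: "a < b" if h: "M (i, j) = Some a" "M (i', j) = Some b" "i < i'" for i i' j a b
  proof -
    obtain k where k: "i' = Suc k" using h(3) by (cases i') auto
    show ?thesis
    proof (cases i)
      case 0
      have b: "F (k, j) = Some b" using h k by (simp add: MS)
      then have "(k, j) \<in> diagram \<nu>" using F(1) by blast
      then have "(0, j) \<in> diagram \<nu>"
        using partition_ferrers[OF \<nu>(1)] unfolding ferrers_def by blast
      then have "a = 0" using zero[of j] h(1) 0 by (simp add: M0)
      moreover have "b \<noteq> 0" using F(4) ranI[of F "(k, j)", OF b] by metis
      ultimately show ?thesis by simp
    next
      case (Suc l)
      then show ?thesis using h k F(3) by (auto simp: MS)
    qed
  qed
  have SSYT: "M \<in> SSYT \<mu>"
    unfolding SSYT_def semistandard_filling_def using dom row col by blast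
  have "below_first_row M = F" by (auto simp: fun_eq_iff MS)
  moreover have "first_row_mult M h = m h" for h
  proof (cases "h = 0")
    case False
    have "{j. M (0, j) = Some h} = {j. j < length L \<and> L ! j = h}" by (auto simp: M0)
    then show ?thesis using False L(2)[of h] by (simp add: first_row_mult_def count_list_eq_card)
  qed (simp add: first_row_mult_def F(6))
  ultimately have "is_SSYT_limit M M'" unfolding is_SSYT_limit_iff M' by auto
  then show ?thesis using \<mu>(1) SSYT lim by blast
qed

section \<open>Cocharge tableaux\<close>

lemma leftmost_exists:
  assumes "M (i, j) = Some h"
  obtains i' j' where "leftmost M h (i', j')"
proof -
  let ?j = "LEAST j. \<exists>i. M (i, j) = Some h"
  have "\<exists>i. M (i, ?j) = Some h" 
    using assms LeastI_ex[of "\<lambda>j. \<exists>i. M (i, j) = Some h"] by blast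
  then obtain i' where "M (i', ?j) = Some h" by blast
  then have "leftmost M h (i', ?j)" unfolding leftmost_def by (auto intro: Least_le)
  then show ?thesis by (rule that)
qed

text \<open>An instance of \<open>h\<close> below the first row lies strictly to the left of those in the first row.\<close>

lemma SSYT_lower_instance_left:
  assumes "\<mu> \<turnstile>\<^sub>p n" "M \<in> SSYT \<mu>" "M (0, j) = Some h" "M (Suc i, j') = Some h"
  shows "j' < j"
proof (rule ccontr)
  assume "\<not> j' < j"
  obtain u where u: "M (0, j') = Some u" "u < h"
    using SSYT_above[OF assms(1,2,4)] by blast
  have "h \<le> u"
  proof (cases "j = j'")
    case True
    then show ?thesis using assms(3) u(1) by simp
  next
    case False
    then show ?thesis using SSYT_D(2)[OF assms(2,3) u(1)] \<open>\<not> j' < j\<close> by simp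
  qed
  then show False using u(2) by simp
qed

lemma leftmost_below_first_row:
  assumes "\<mu> \<turnstile>\<^sub>p n" "M \<in> SSYT \<mu>"
  shows "leftmost (below_first_row M) h (i, j) \<longleftrightarrow> leftmost M h (Suc i, j)"
proof
  assume l: "leftmost (below_first_row M) h (i, j)"
  then have M: "M (Suc i, j) = Some h" by (simp add: leftmost_def)
  have "j \<le> j'" if "M (i', j') = Some h" for i' j'
  proof (cases i')
    case 0
    then show ?thesis using SSYT_lower_instance_left[OF assms _ M] that by fastforce
  next
    case (Suc k)
    then show ?thesis using l that by (auto simp: leftmost_def)
  qed
  then show "leftmost M h (Suc i, j)" using M by (auto simp: leftmost_def)
qed (auto simp: leftmost_def)

text \<open>
  For a cell below the first row, the cocharge conditions on \<open>M\<close> and on its limit agree.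
\<close>

lemma cocharge_condition_below_first_row:
  assumes "\<mu> \<turnstile>\<^sub>p n" "M \<in> SSYT \<mu>" "h > 0" "M (Suc i, j) = Some h"
  shows "(\<exists>i'<Suc i. \<exists>j'. M (i', j') = Some (h - 1)) \<longleftrightarrow>
    (\<exists>i'<i. \<exists>j'. below_first_row M (i', j') = Some (h - 1)) \<or> h - 1 = 0 \<or>
      first_row_mult M (h - 1) > 0"
proof -
  have "(\<exists>i'<Suc i. \<exists>j'. M (i', j') = Some (h - 1)) \<longleftrightarrow>
      (\<exists>i'<i. \<exists>j'. below_first_row M (i', j') = Some (h - 1)) \<or> (\<exists>j'. M (0, j') = Some (h - 1))"
    by (auto simp: Ex_less_Suc2)
  moreover have "(\<exists>j'. M (0, j') = Some (h - 1)) \<longleftrightarrow> h - 1 = 0 \<or> first_row_mult M (h - 1) > 0"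
  proof (cases "h - 1 = 0")
    case True
    obtain u where "M (0, j) = Some u" "u < h" using SSYT_above[OF assms(1,2,4)] by blast
    \<comment> \<open>Here \<open>h = 1\<close>, so the entry above a 1 below the first row is 0.\<close>
    then have "M (0, j) = Some (h - 1)" using True by simp
    then show ?thesis using True by blast
  next
    case False
    then show ?thesis using first_row_mult_pos_iff[OF assms(2), of "h - 1"] by simp
  qed
  ultimately show ?thesis by simp
qed

lemma CCT_iff_limit_in_inf_CCT:
  assumes "\<mu> \<turnstile>\<^sub>p n" "C \<in> SSYT \<mu>"
  shows "C \<in> CCT \<mu> \<longleftrightarrow> (below_first_row C, first_row_mult C) \<in> inf_CCT (diagram_limit \<mu>)"
proof
  assume "C \<in> CCT \<mu>"
  then have cc: "\<exists>i'<i. \<exists>j'. C (i', j') = Some (h - 1)" if "h > 0" "leftmost C h (i, j)" for h i j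
    using that unfolding CCT_def by blast
  have mult: "h \<in> ran (below_first_row C)" if h: "h > 0" "first_row_mult C h > 0" for h
  proof -
    obtain j where "C (0, j) = Some h" using first_row_mult_pos_iff[OF assms(2)] h by blast
    then obtain i' j' where l: "leftmost C h (i', j')" by (rule leftmost_exists)
    have "i' \<noteq> 0" using cc[OF h(1) l] by auto
    then obtain k where "i' = Suc k" by (cases i') auto
    then have "below_first_row C (k, j') = Some h" using l by (simp add: leftmost_def)
    then show ?thesis by (rule ranI)
  qed
  have left: "(\<exists>i'<i. \<exists>j'. below_first_row C (i', j') = Some (h - 1)) \<or> h - 1 = 0 \<or>
      first_row_mult C (h - 1) > 0"
    if h: "h > 0" "leftmost (below_first_row C) h (i, j)" for h i j
  proof -
    have l: "leftmost C h (Suc i, j)" using h(2) leftmost_below_first_row[OF assms] by blast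
    then have "C (Suc i, j) = Some h" by (simp add: leftmost_def)
    from cocharge_condition_below_first_row[OF assms h(1) this] cc[OF h(1) l]
    show ?thesis by (rule iffD1)
  qed
  show "(below_first_row C, first_row_mult C) \<in> inf_CCT (diagram_limit \<mu>)"
    unfolding inf_CCT_def
    by (intro CollectI case_prodI conjI allI impI limit_in_inf_SSYT[OF assms] mult left)
next
  assume "(below_first_row C, first_row_mult C) \<in> inf_CCT (diagram_limit \<mu>)"
  then have mult: "\<forall>h>0. first_row_mult C h > 0 \<longrightarrow> h \<in> ran (below_first_row C)"
    and cc: "\<forall>h>0. \<forall>i j. leftmost (below_first_row C) h (i, j) \<longrightarrow>
      (\<exists>i'<i. \<exists>j'. below_first_row C (i', j') = Some (h - 1)) \<or> h - 1 = 0 \<or>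
        first_row_mult C (h - 1) > 0"
    unfolding inf_CCT_def mem_Collect_eq prod.case by - (elim conjE, assumption)+
  have "\<exists>i'<i. \<exists>j'. C (i', j') = Some (h - 1)" if h: "h > 0" "leftmost C h (i, j)" for h i j
  proof (cases i)
    case 0
    \<comment> \<open>Impossible: \<open>h\<close> also occurs in a lower row, and hence further to the left.\<close>
    then have C0: "C (0, j) = Some h" using h(2) by (simp add: leftmost_def)
    then have "h \<in> ran (below_first_row C)"
      using mult h(1) first_row_mult_pos_iff[OF assms(2) h(1)] by blast
    then obtain k j' where k: "C (Suc k, j') = Some h" by (auto simp: ran_def)
    then have "j' < j" by (rule SSYT_lower_instance_left[OF assms C0])
    moreover have "j \<le> j'" using h(2) k by (auto simp: leftmost_def)
    ultimately show ?thesis by simp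
  next
    case (Suc k)
    then have l: "leftmost (below_first_row C) h (k, j)" and C: "C (Suc k, j) = Some h"
      using h(2) leftmost_below_first_row[OF assms] by (auto simp: leftmost_def)
    from cocharge_condition_below_first_row[OF assms h(1) C] cc[rule_format, OF h(1) l]
    show ?thesis unfolding Suc by (rule iffD2)
  qed
  then show "C \<in> CCT \<mu>" using assms(2) unfolding CCT_def by blast
qed

theorem lemma2p8:
  shows
   "((\<forall>n \<mu>. \<mu> \<turnstile>\<^sub>p n \<longrightarrow>
        inf_ferrers (diagram_limit \<mu>) \<and> finite_part (diagram_limit \<mu>) = diagram (tl \<mu>)) \<and>
     (\<forall>D. inf_ferrers D \<longrightarrow> (\<exists>n \<mu>. \<mu> \<turnstile>\<^sub>p n \<and> diagram_limit \<mu> = D)))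
    \<and>
    ((\<forall>n \<mu> T. \<mu> \<turnstile>\<^sub>p n \<and> T \<in> SYT \<mu> \<longrightarrow>
        (\<exists>T' \<in> inf_SYT (diagram_limit \<mu>). is_SYT_limit T T')) \<and>
     (\<forall>D T'. inf_ferrers D \<and> T' \<in> inf_SYT D \<longrightarrow>
        (\<exists>n \<mu> T. \<mu> \<turnstile>\<^sub>p n \<and> T \<in> SYT \<mu> \<and> diagram_limit \<mu> = D \<and> is_SYT_limit T T')))
    \<and>
    ((\<forall>n \<mu> M. \<mu> \<turnstile>\<^sub>p n \<and> M \<in> SSYT \<mu> \<longrightarrow>
        (\<exists>M' \<in> inf_SSYT (diagram_limit \<mu>). is_SSYT_limit M M')) \<and>
     (\<forall>D M'. inf_ferrers D \<and> M' \<in> inf_SSYT D \<longrightarrow>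
        (\<exists>n \<mu> M. \<mu> \<turnstile>\<^sub>p n \<and> M \<in> SSYT \<mu> \<and> diagram_limit \<mu> = D \<and> is_SSYT_limit M M')))
    \<and>
    ((\<forall>n \<mu> C. \<mu> \<turnstile>\<^sub>p n \<and> C \<in> CCT \<mu> \<longrightarrow>
        (\<exists>C' \<in> inf_CCT (diagram_limit \<mu>). is_SSYT_limit C C')) \<and>
     (\<forall>n \<mu> C C'. \<mu> \<turnstile>\<^sub>p n \<and> C \<in> SSYT \<mu> \<and> is_SSYT_limit C C' \<and>
        C' \<in> inf_CCT (diagram_limit \<mu>) \<longrightarrow> C \<in> CCT \<mu>))"
proof (intro conjI allI impI; (elim conjE)?)
  fix n \<mu> assume \<mu>: "\<mu> \<turnstile>\<^sub>p n"
  show "inf_ferrers (diagram_limit \<mu>)" using \<mu> by (rule inf_ferrers_diagram_limit)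
  show "finite_part (diagram_limit \<mu>) = diagram (tl \<mu>)" by simp
next
  fix D assume "inf_ferrers D"
  then show "\<exists>n \<mu>. \<mu> \<turnstile>\<^sub>p n \<and> diagram_limit \<mu> = D" by (rule inf_ferrers_is_limit)
next
  fix n \<mu> T assume h: "\<mu> \<turnstile>\<^sub>p n" "T \<in> SYT \<mu>"
  have "dom T = diagram \<mu>" using h(2) by (simp add: SYT_def standard_filling_def)
  moreover have "sum_list \<mu> = n" using h(1) by (simp add: is_partition_def)
  ultimately have "is_SYT_limit T (continue_row (first_row \<mu>) n T)"
    using is_SYT_limit_iff by blast
  then show "\<exists>T' \<in> inf_SYT (diagram_limit \<mu>). is_SYT_limit T T'"
    using continue_row_inf_SYT[OF h] by blast
next
  fix D T' assume "inf_ferrers D" "T' \<in> inf_SYT D"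
  then show "\<exists>n \<mu> T. \<mu> \<turnstile>\<^sub>p n \<and> T \<in> SYT \<mu> \<and> diagram_limit \<mu> = D \<and> is_SYT_limit T T'"
    by (rule inf_SYT_is_limit)
next
  fix n \<mu> M assume "\<mu> \<turnstile>\<^sub>p n" "M \<in> SSYT \<mu>"
  then have "(below_first_row M, first_row_mult M) \<in> inf_SSYT (diagram_limit \<mu>)"
    by (rule limit_in_inf_SSYT)
  then show "\<exists>M' \<in> inf_SSYT (diagram_limit \<mu>). is_SSYT_limit M M'"
    by (simp add: is_SSYT_limit_iff bexI)
next
  fix D M' assume "inf_ferrers D" "M' \<in> inf_SSYT D"
  then show "\<exists>n \<mu> M. \<mu> \<turnstile>\<^sub>p n \<and> M \<in> SSYT \<mu> \<and> diagram_limit \<mu> = D \<and> is_SSYT_limit M M'"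
    by (rule inf_SSYT_is_limit)
next
  fix n \<mu> C assume h: "\<mu> \<turnstile>\<^sub>p n" "C \<in> CCT \<mu>"
  then have "C \<in> SSYT \<mu>" by (simp add: CCT_def)
  then have "(below_first_row C, first_row_mult C) \<in> inf_CCT (diagram_limit \<mu>)"
    using h CCT_iff_limit_in_inf_CCT by simp
  then show "\<exists>C' \<in> inf_CCT (diagram_limit \<mu>). is_SSYT_limit C C'"
    by (simp add: is_SSYT_limit_iff bexI)
next
  fix n \<mu> C C'
  assume "\<mu> \<turnstile>\<^sub>p n" "C \<in> SSYT \<mu>" "is_SSYT_limit C C'" "C' \<in> inf_CCT (diagram_limit \<mu>)"
  then show "C \<in> CCT \<mu>" by (simp add: CCT_iff_limit_in_inf_CCT is_SSYT_limit_iff)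
qed

end
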